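(* For all $n\in\mathbb{N}$ we have $$\sqrt{2\pi}\left(\frac{n+a_*}{e}\right)^{n+a_*}<n!<\sqrt{2\pi}\left(\frac{n+a^*}{e}\right)^{n+a^*},$$ where the constants $a_*=0.428844044...$ and $a^*=0.5$ are the best possible.
   Context: Here $\mathbb{N}$ denotes the set of positive integers, $n!$ is the factorial of $n$, and $e$ is the base of the natural logarithm.
   Formalization: For the exact best possible a_* the lower inequality is an equality at n=1, so it is stated with ≤, with equality exactly at n=1 (strict for n≥2); strictness for all n≥1 is asserted for every shift 0≤a<a_*, and no shift strict for all n exceeds a_*. *)

theory Defs
  imports "HOL-Analysis.Analysis"
begin

text \<open>
  The approximation with shift \<open>a\<close>.  The real power is meaningful only for \<open>n + a > 0\<close>;
  the condition \<open>a > -1\<close> says that this holds for every \<open>n \<ge> 1\<close>.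
\<close>

definition shifted_stirling :: "real \<Rightarrow> nat \<Rightarrow> real" where
  "shifted_stirling a n = sqrt (2 * pi) * ((real n + a) / exp 1) powr (real n + a)"

definition lower_shift :: "real \<Rightarrow> bool" where
  "lower_shift a \<longleftrightarrow> a > -1 \<and> (\<forall>n\<ge>1. shifted_stirling a n < fact n)"

definition upper_shift :: "real \<Rightarrow> bool" where
  "upper_shift a \<longleftrightarrow> a > -1 \<and> (\<forall>n\<ge>1. fact n < shifted_stirling a n)"

end

theory Submission
  imports Defs "HOL-Real_Asymp.Real_Asymp"
begin

text \<open>
  Let \<open>F x = x ln x - x\<close>, the primitive of the logarithm, so that the approximation with
  shift \<open>a\<close> is \<open>exp (ln (sqrt (2 pi)) + F (n + a))\<close>, and comparing it with \<open>n!\<close> amounts to finding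
  the sign of the defect \<open>D a n = ln n! - ln (sqrt (2 pi)) - F (n + a)\<close>.

  Everything rests on one monotonicity (\<open>defect_strict_increasing\<close>): for \<open>-1 < a \<le> 1/2\<close> the
  defect strictly increases in \<open>n\<close>. Its increment is \<open>ln (n + 1)\<close> minus the integral of \<open>ln\<close> over
  an interval of length 1 with midpoint \<open>n + a + 1/2 \<le> n + 1\<close>, and by strict concavity this
  integral is below the value of \<open>ln\<close> at the midpoint.

  For \<open>a = 1/2\<close> the defect tends to 0, which is Stirling's formula (\<open>defect_half_tendsto\<close>). Being
  strictly increasing, it is negative throughout: this is the upper bound. For \<open>a < 1/2\<close> the defect
  exceeds the one for \<open>1/2\<close> by at least \<open>(1/2 - a) ln (n + a)\<close>, which is unbounded, so no
  smaller shift gives an upper bound.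

  For the lower bound the monotonicity makes \<open>n = 1\<close> the worst case. The constant \<open>a\<close> is the one with
  \<open>D a 1 = 0\<close>, that is \<open>F (1 + a) = - ln (2 pi) / 2\<close>. Since \<open>F\<close> strictly increases on \<open>[1, \<infinity>)\<close>, a
  smaller nonnegative shift makes \<open>D a 1\<close> positive and a larger one makes it negative. The decimals
  of this \<open>a\<close> come from rational bounds for three logarithms.
\<close>

section \<open>The primitive of the logarithm\<close>

definition ln_primitive :: "real \<Rightarrow> real" where
  "ln_primitive x = x * ln x - x"

lemma ln_primitive_has_derivative:
  assumes "x > 0"
  shows "(ln_primitive has_real_derivative ln x) (at x)"
  unfolding ln_primitive_def using assms
  by (auto intro!: derivative_eq_intros simp: field_simps)

lemma continuous_on_ln_primitive:
  assumes "\<And>x. x \<in> S \<Longrightarrow> x > 0"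
  shows "continuous_on S ln_primitive"
  using assms DERIV_isCont ln_primitive_has_derivative
  by (intro continuous_at_imp_continuous_on) blast

lemma ln_primitive_strict_mono:
  assumes "1 \<le> x" "x < y"
  shows "ln_primitive x < ln_primitive y"
proof (rule DERIV_pos_imp_increasing_open[OF \<open>x < y\<close>])
  fix t assume "x < t" "t < y"
  with assms show "\<exists>d. (ln_primitive has_real_derivative d) (at t) \<and> d > 0"
    using ln_primitive_has_derivative[of t] by (intro exI[of _ "ln t"]) auto
next
  show "continuous_on {x..y} ln_primitive"
    using assms by (intro continuous_on_ln_primitive) auto
qed

lemma ln_primitive_above_tangent:
  assumes "x > 0" "y > 0"
  shows "ln_primitive y - ln_primitive x \<ge> (y - x) * ln x"
proof -
  have "ln (x / y) \<le> x / y - 1"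
    using assms by (intro ln_le_minus_one) simp
  hence "y * (ln x - ln y) \<le> y * (x / y - 1)"
    using assms by (intro mult_left_mono) (auto simp: ln_div)
  also have "\<dots> = x - y" using assms by (simp add: field_simps)
  finally show ?thesis by (simp add: ln_primitive_def algebra_simps)
qed

text \<open>
  The left-hand side is the integral of \<open>ln\<close> over \<open>[m - 1/2, m + 1/2]\<close>. Replacing \<open>ln\<close> by its
  tangent at \<open>m\<close> increases the integral, strictly on both halves, and the integral of the tangent
  is \<open>ln m\<close>.
\<close>

lemma ln_integral_less_midpoint:
  fixes m :: real
  assumes "m > 1/2"
  shows "ln_primitive (m + 1/2) - ln_primitive (m - 1/2) < ln m"
proof -
  \<comment> \<open>a primitive of \<open>ln\<close> minus its tangent at \<open>m\<close>; the quadratic term is equal at \<open>m - 1/2\<close> and \<open>m + 1/2\<close>\<close>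
  define G where "G = (\<lambda>t. ln_primitive t - t * ln m - (t - m)\<^sup>2 / (2 * m))"
  have deriv: "(G has_real_derivative (ln t - ln m - (t - m) / m)) (at t)" if "t > 0" for t
    unfolding G_def using that assms
    by (auto intro!: derivative_eq_intros ln_primitive_has_derivative simp: field_simps)
  have neg: "ln t - ln m - (t - m) / m < 0" if "t > 0" "t \<noteq> m" for t
  proof -
    have "ln (t / m) < t / m - 1"
      using that assms ln_eq_minus_one[of "t / m"] ln_le_minus_one[of "t / m"]
      by (cases "ln (t / m) = t / m - 1") auto
    thus ?thesis using that assms by (simp add: ln_div diff_divide_distrib)
  qed
  have decr: "G v < G u" if "0 < u" "u < v" "m \<le> u \<or> v \<le> m" for u v
  proof (rule DERIV_neg_imp_decreasing_open[OF \<open>u < v\<close>])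
    fix t assume t: "u < t" "t < v"
    hence "t > 0" "t \<noteq> m" using that by auto
    thus "\<exists>d. (G has_real_derivative d) (at t) \<and> d < 0"
      using deriv neg by blast
  next
    show "continuous_on {u..v} G"
    proof (intro continuous_at_imp_continuous_on ballI)
      fix t assume "t \<in> {u..v}"
      hence "t > 0" using that by auto
      from DERIV_isCont[OF deriv[OF this]] show "isCont G t" .
    qed
  qed
  have "G (m + 1/2) < G m" using assms by (intro decr) auto
  also have "G m < G (m - 1/2)" using assms by (intro decr) auto
  finally show ?thesis
    by (simp add: G_def algebra_simps)
qed

text \<open>
  The left-hand side is the trapezoidal rule for the integral of the concave function \<open>ln\<close> on
  the right. Written out, the claim is \<open>ln (1 + 1/x) \<ge> 2 / (2 x + 1)\<close>, where the right-hand side is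
  the first term of the series of \<open>ln\<close> in powers of \<open>(t - 1) / (t + 1)\<close> at \<open>t = 1 + 1/x\<close>.
\<close>

lemma ln_trapezoid_le_integral:
  fixes x :: real
  assumes "x > 0"
  shows "(ln x + ln (x + 1)) / 2 \<le> ln_primitive (x + 1) - ln_primitive x"
proof -
  define r where "r = (x + 1) / x"
  have r: "r > 1" using assms by (simp add: r_def)
  have "(r - 1) / (r + 1) = 1 / (2 * x + 1)"
    using assms by (simp add: r_def field_simps)
  hence "2 / (2 * x + 1) \<le> ln r"
    using ln_approx_bounds[OF r, of 1] by simp
  hence "2 / (2 * x + 1) \<le> ln (x + 1) - ln x"
    using assms by (simp add: r_def ln_div)
  hence "2 \<le> (ln (x + 1) - ln x) * (2 * x + 1)"
    using assms by (simp add: field_simps)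
  thus ?thesis by (simp add: ln_primitive_def field_simps)
qed

section \<open>The defect of the shifted approximation\<close>

definition defect :: "real \<Rightarrow> nat \<Rightarrow> real" where
  "defect a n = ln (fact n) - ln (2 * pi) / 2 - ln_primitive (real n + a)"

lemma shifted_stirling_eq_exp:
  assumes "real n + a > 0"
  shows "shifted_stirling a n = fact n * exp (- defect a n)"
proof -
  have "((real n + a) / exp 1) powr (real n + a) = exp (ln_primitive (real n + a))"
    using assms by (simp add: powr_def ln_div ln_primitive_def algebra_simps)
  moreover have "sqrt (2 * pi) = exp (ln (2 * pi) / 2)"
    by (simp add: ln_sqrt flip: ln_sqrt)
  ultimately have "shifted_stirling a n = exp (ln (2 * pi) / 2 + ln_primitive (real n + a))"
    by (simp add: shifted_stirling_def exp_add)
  also have "\<dots> = exp (ln (fact n) + - defect a n)" by (simp add: defect_def)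
  also have "\<dots> = fact n * exp (- defect a n)" by (subst exp_add) simp
  finally show ?thesis .
qed

lemma
  assumes "a > -1" "n \<ge> 1"
  shows shifted_stirling_less_iff: "shifted_stirling a n < fact n \<longleftrightarrow> defect a n > 0"
    and shifted_stirling_greater_iff: "fact n < shifted_stirling a n \<longleftrightarrow> defect a n < 0"
    and shifted_stirling_eq_iff: "shifted_stirling a n = fact n \<longleftrightarrow> defect a n = 0"
proof -
  have "real n + a > 0" using assms by linarith
  note eq = shifted_stirling_eq_exp[OF this]
  show "shifted_stirling a n < fact n \<longleftrightarrow> defect a n > 0"
    "fact n < shifted_stirling a n \<longleftrightarrow> defect a n < 0"
    "shifted_stirling a n = fact n \<longleftrightarrow> defect a n = 0"
    unfolding eq by simp_all
qed

lemma defect_less_Suc: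
  assumes "-1 < a" "a \<le> 1/2" "n \<ge> 1"
  shows "defect a n < defect a (Suc n)"
proof -
  define m where "m = real n + a + 1/2"
  have m: "m > 1/2" "m \<le> real n + 1" using assms by (auto simp: m_def)
  have "ln_primitive (m + 1/2) - ln_primitive (m - 1/2) < ln m"
    using m by (intro ln_integral_less_midpoint)
  also have "ln m \<le> ln (real n + 1)" using m by simp
  finally have "ln_primitive (real n + 1 + a) - ln_primitive (real n + a) < ln (real n + 1)"
    by (simp add: m_def add_ac)
  moreover have "ln (fact (Suc n) :: real) = ln (real n + 1) + ln (fact n)"
    by (simp add: ln_mult add_ac)
  ultimately show ?thesis by (simp add: defect_def add_ac)
qed

lemma defect_strict_increasing:
  assumes "-1 < a" "a \<le> 1/2" "1 \<le> m" "m < n"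
  shows "defect a m < defect a n"
proof -
  have "Suc m \<le> n" using assms by simp
  thus ?thesis
  proof (induction n rule: dec_induct)
    case base
    show ?case using assms by (intro defect_less_Suc) auto
  next
    case (step k)
    have "defect a k < defect a (Suc k)"
      using assms step by (intro defect_less_Suc) auto
    with step.IH show ?case by linarith
  qed
qed

section \<open>Stirling's formula\<close>

text \<open>
  This bound makes the increasing sequence \<open>defect (1/2)\<close> converge. The sequence
  \<open>ln n! - F n - ln n / 2\<close> decreases by the trapezoidal rule, and it dominates
  \<open>ln n! - F (n + 1/2)\<close> because \<open>F\<close> lies above its tangent at \<open>n\<close>.
\<close>

lemma defect_half_bounded:
  assumes "n \<ge> 1"
  shows "defect (1/2) n \<le> 1 - ln (2 * pi) / 2"
proof -
  have "ln (fact n) - ln_primitive (real n) - ln (real n) / 2 \<le> 1"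
    using assms
  proof (induction n rule: dec_induct)
    case base
    show ?case by (simp add: ln_primitive_def)
  next
    case (step n)
    have "ln (fact (Suc n) :: real) = ln (real n + 1) + ln (fact n)"
      by (simp add: ln_mult add_ac)
    moreover have "(ln (real n) + ln (real n + 1)) / 2
        \<le> ln_primitive (real n + 1) - ln_primitive (real n)"
      using step by (intro ln_trapezoid_le_integral) simp
    ultimately show ?case using step.IH by (simp add: add_ac)
  qed
  moreover have "(real n + 1/2 - real n) * ln (real n)
      \<le> ln_primitive (real n + 1/2) - ln_primitive (real n)"
    using assms by (intro ln_primitive_above_tangent) auto
  ultimately show ?thesis by (simp add: defect_def)
qed

lemma wallis_product_eq:
  "(\<Prod>k=1..n. (4 * real k ^ 2) / (4 * real k ^ 2 - 1))
     = 2 ^ (4 * n) * fact n ^ 4 / (fact (2 * n) ^ 2 * (2 * real n + 1))"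
proof (induction n)
  case (Suc n)
  define A B x :: real where "A = fact n" and "B = fact (2 * n)" and "x = real n"
  have fact_A: "fact (Suc n) = (x + 1) * A" by (simp add: A_def x_def)
  have fact_B: "fact (2 * Suc n) = (2 * (x + 1)) * (2 * x + 1) * B"
    by (simp add: B_def x_def algebra_simps)
  have factor: "4 * real (Suc n) ^ 2 / (4 * real (Suc n) ^ 2 - 1)
      = 4 * (x + 1) ^ 2 / ((2 * x + 1) * (2 * x + 3))"
    by (simp add: x_def power2_eq_square algebra_simps)
  have nz: "B \<noteq> 0" "2 * x + 1 > 0" "2 * x + 3 > 0" "x + 1 > 0"
    by (auto simp: B_def x_def)
  have "(\<Prod>k=1..Suc n. (4 * real k ^ 2) / (4 * real k ^ 2 - 1))
      = 2 ^ (4 * n) * A ^ 4 / (B ^ 2 * (2 * x + 1)) * (4 * (x + 1) ^ 2 / ((2 * x + 1) * (2 * x + 3)))"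
    using Suc.IH factor by (simp add: A_def B_def x_def)
  also have "\<dots> = 2 ^ (4 * n) * 16 * ((x + 1) * A) ^ 4
      / (((2 * (x + 1)) * (2 * x + 1) * B) ^ 2 * (2 * x + 3))"
    using nz by (simp add: divide_simps) (simp add: eval_nat_numeral algebra_simps)
  also have "\<dots> = 2 ^ (4 * Suc n) * fact (Suc n) ^ 4
      / (fact (2 * Suc n) ^ 2 * (2 * real (Suc n) + 1))"
  proof -
    have "2 ^ (4 * Suc n) = (2 ^ (4 * n) * 16 :: real)" by (simp add: power_add)
    moreover have "2 * real (Suc n) + 1 = 2 * x + 3" by (simp add: x_def)
    ultimately show ?thesis unfolding fact_A fact_B by simp
  qed
  finally show ?case .
qed simp

text \<open>
  The limit \<open>L\<close> exists by monotone convergence. In the logarithm of the Wallis product the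
  factorials combine to \<open>4 ln n! - 2 ln (2n)!\<close>, which expresses \<open>2 L\<close> through \<open>ln (pi/2)\<close> and an
  elementary limit; the constant \<open>ln (2 pi) / 2\<close> in the defect is the one making \<open>L\<close> vanish.
\<close>

lemma defect_half_tendsto: "defect (1/2) \<longlonglongrightarrow> 0"
proof -
  have "\<exists>L. (\<lambda>n. defect (1/2) (Suc n)) \<longlonglongrightarrow> L"
  proof -
    have "incseq (\<lambda>n. defect (1/2) (Suc n))"
      by (intro incseq_SucI less_imp_le[OF defect_less_Suc]) auto
    moreover have "\<And>n. defect (1/2) (Suc n) \<le> 1 - ln (2 * pi) / 2"
      by (intro defect_half_bounded) auto
    ultimately show ?thesis using incseq_convergent by blast
  qed
  then obtain L where L: "defect (1/2) \<longlonglongrightarrow> L"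
    using filterlim_sequentially_Suc by blast
  have L2: "(\<lambda>n. defect (1/2) (2 * n)) \<longlonglongrightarrow> L"
    using LIMSEQ_subseq_LIMSEQ[OF L, of "\<lambda>n. 2 * n"] by (simp add: strict_mono_def o_def)
  define W where "W = (\<lambda>n. \<Prod>k=1..n. (4 * real k ^ 2) / (4 * real k ^ 2 - 1))"
  define E where "E = (\<lambda>n. real (4 * n) * ln 2 + 4 * ln_primitive (real n + 1/2)
      - 2 * ln_primitive (2 * real n + 1/2) - ln (2 * real n + 1) + ln (2 * pi))"
  have "ln (W n) = 4 * defect (1/2) n - 2 * defect (1/2) (2 * n) + E n" for n
  proof -
    have "ln (W n) = real (4 * n) * ln 2 + 4 * ln (fact n)
        - (2 * ln (fact (2 * n)) + ln (2 * real n + 1))"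
      unfolding W_def wallis_product_eq
      by (simp add: ln_divide_pos ln_mult_pos ln_realpow)
    thus ?thesis by (simp add: defect_def E_def algebra_simps)
  qed
  moreover have "(\<lambda>n. 4 * defect (1/2) n - 2 * defect (1/2) (2 * n) + E n)
      \<longlonglongrightarrow> 4 * L - 2 * L + (ln (2 * pi) - 2 * ln 2)"
  proof (intro tendsto_intros L L2)
    show "E \<longlonglongrightarrow> ln (2 * pi) - 2 * ln 2"
      unfolding E_def ln_primitive_def by real_asymp
  qed
  ultimately have "(\<lambda>n. ln (W n)) \<longlonglongrightarrow> 2 * L + (ln (2 * pi) - 2 * ln 2)" by simp
  moreover have "(\<lambda>n. ln (W n)) \<longlonglongrightarrow> ln (pi / 2)"
    using wallis unfolding W_def by (intro tendsto_ln) auto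
  ultimately have "2 * L + (ln (2 * pi) - 2 * ln 2) = ln (pi / 2)"
    by (rule LIMSEQ_unique)
  hence "L = 0" by (simp add: ln_mult ln_div)
  with L show ?thesis by simp
qed

lemma defect_half_neg:
  assumes "n \<ge> 1"
  shows "defect (1/2) n < 0"
proof -
  have "defect (1/2) (Suc n) \<le> 0"
  proof (rule LIMSEQ_le_const[OF defect_half_tendsto], intro exI allI impI)
    fix k assume "Suc n \<le> k"
    thus "defect (1/2) (Suc n) \<le> defect (1/2) k"
      using defect_strict_increasing[of "1/2" "Suc n" k] by (cases "k = Suc n") auto
  qed
  moreover have "defect (1/2) n < defect (1/2) (Suc n)"
    using assms by (intro defect_less_Suc) auto
  ultimately show ?thesis by linarith
qed

text \<open>
  By the tangent of \<open>F\<close> at \<open>n + a\<close>, the defect for \<open>a\<close> exceeds the one for \<open>1/2\<close>, which tends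
  to 0, by at least \<open>(1/2 - a) ln (n + a)\<close>.
\<close>

lemma defect_eventually_pos:
  assumes "-1 < a" "a < 1/2"
  shows "\<exists>n\<ge>1. defect a n > 0"
proof -
  have "filterlim (\<lambda>n::nat. (1/2 - a) * ln (real n + a)) at_top sequentially"
    using assms by real_asymp
  hence "filterlim (\<lambda>n. defect (1/2) n + (1/2 - a) * ln (real n + a)) at_top sequentially"
    by (rule filterlim_tendsto_add_at_top[OF defect_half_tendsto])
  hence "eventually (\<lambda>n. defect (1/2) n + (1/2 - a) * ln (real n + a) > 0 \<and> n \<ge> 1) sequentially"
    by (intro eventually_conj eventually_ge_at_top) (auto simp: filterlim_at_top_dense)
  then obtain n where n: "defect (1/2) n + (1/2 - a) * ln (real n + a) > 0" "n \<ge> 1"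
    by (auto simp: eventually_at_top_linorder)
  have "(real n + 1/2 - (real n + a)) * ln (real n + a)
      \<le> ln_primitive (real n + 1/2) - ln_primitive (real n + a)"
    using assms n by (intro ln_primitive_above_tangent) auto
  with n have "defect a n > 0" by (simp add: defect_def)
  with n show ?thesis by blast
qed

section \<open>The decimals of the lower constant\<close>

text \<open>
  The inequalities \<open>F (1.428844044) < - ln (2 pi) / 2 < F (1.428844045)\<close> hold with margins of about
  \<open>6 / 10^11\<close> and \<open>3 / 10^10\<close>, so the logarithms are enclosed with errors of at most a few units of
  \<open>10^-12\<close>. The arguments \<open>2 pi = 4 (11/7) / (22 / (7 pi))\<close> and
  \<open>1.42884404... = (10/7) (1.0001908...)\<close> are split into
  fractions with small numerator and denominator, whose series terms stay short rationals, and
  factors close to 1, for which two terms of the series suffice.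
\<close>

lemma ln_2_bounds: "ln (2::real) \<in> {0.6931471805598..0.6931471805601}"
  using ln_approx_bounds[of 2 12] by (simp add: lessThan_nat_numeral power_divide)

lemma ln_11_7_bounds: "ln (11 / 7 :: real) \<in> {0.451985123743..0.451985123744}"
  using ln_approx_bounds[of "11 / 7" 9] by (simp add: lessThan_nat_numeral power_divide)

lemma ln_10_7_bounds: "ln (10 / 7 :: real) \<in> {0.356674943938..0.356674943939}"
  using ln_approx_bounds[of "10 / 7" 8] by (simp add: lessThan_nat_numeral power_divide)

lemma ln_two_pi_bounds: "ln (2 * pi) \<in> {1.837877066408..1.837877066411}"
proof -
  define c d :: real where "c = 3.141592653588" and "d = 3.1415926535899"
  have pos: "c > 0" "d > 0" by (simp_all add: c_def d_def)
  have split: "ln (22 / (7 * t)) = ln 2 + ln (11 / 7) - ln t" if "t > 0" for t :: real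
    using ln_divide_pos[of "22 / 7" t] ln_mult_pos[of 2 "11 / 7 :: real"] that by simp
  have "ln (22 / (7 * c)) \<le> 0.0004024184542" "0.0004024184534 \<le> ln (22 / (7 * d))"
    using ln_approx_bounds[of "22 / (7 * c)" 2] ln_approx_bounds[of "22 / (7 * d)" 2]
    by (simp_all add: c_def d_def lessThan_nat_numeral power_divide)
  hence "ln 2 + ln (11 / 7) - ln c \<le> 0.0004024184542"
    "0.0004024184534 \<le> ln 2 + ln (11 / 7) - ln d"
    unfolding split[OF pos(1)] split[OF pos(2)] .
  moreover have "ln c \<le> ln pi" "ln pi \<le> ln d"
    using pi_approx pos by (simp_all add: c_def d_def)
  moreover have "ln (2 * pi) = ln 2 + ln pi" by (simp add: ln_mult_pos)
  moreover have "0.6931471805598 \<le> ln (2 :: real)" "ln (2 :: real) \<le> 0.6931471805601"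
    "0.451985123743 \<le> ln (11 / 7 :: real)" "ln (11 / 7 :: real) \<le> 0.451985123744"
    using ln_2_bounds ln_11_7_bounds by auto
  ultimately have "1.837877066408 \<le> ln (2 * pi)" "ln (2 * pi) \<le> 1.837877066411" by simp_all
  thus ?thesis by simp
qed

lemma ln_primitive_at_lower_decimal:
  "ln_primitive (1 + 428844044 / 10 ^ 9) < - ln (2 * pi) / 2"
proof -
  define x :: real where "x = 1 + 428844044 / 10 ^ 9"
  have "ln (x / (10 / 7)) \<le> 0.000190812595"
    using ln_approx_bounds[of "x / (10 / 7)" 2]
    by (simp add: x_def lessThan_nat_numeral power_divide)
  moreover have "ln (x / (10 / 7)) = ln x - ln (10 / 7)"
    by (rule ln_divide_pos) (simp_all add: x_def)
  moreover have "ln (10 / 7 :: real) \<le> 0.356674943939" using ln_10_7_bounds by auto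
  ultimately have "ln x \<le> 0.356865756534" by linarith
  hence "x * ln x \<le> x * 0.356865756534" by (intro mult_left_mono) (auto simp: x_def)
  hence "ln_primitive x \<le> x * 0.356865756534 - x" by (simp only: ln_primitive_def diff_right_mono)
  moreover have "x * 0.356865756534 - x < - 1.837877066411 / 2" by (simp add: x_def)
  moreover have "ln (2 * pi) \<le> 1.837877066411" using ln_two_pi_bounds by auto
  ultimately have "ln_primitive x < - ln (2 * pi) / 2" by simp
  thus ?thesis by (simp only: x_def)
qed

lemma ln_primitive_at_upper_decimal:
  "- ln (2 * pi) / 2 < ln_primitive (1 + 428844045 / 10 ^ 9)"
proof -
  define x :: real where "x = 1 + 428844045 / 10 ^ 9"
  have "0.000190813293 \<le> ln (x / (10 / 7))"
    using ln_approx_bounds[of "x / (10 / 7)" 2]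
    by (simp add: x_def lessThan_nat_numeral power_divide)
  moreover have "ln (x / (10 / 7)) = ln x - ln (10 / 7)"
    by (rule ln_divide_pos) (simp_all add: x_def)
  moreover have "0.356674943938 \<le> ln (10 / 7 :: real)" using ln_10_7_bounds by auto
  ultimately have "0.356865757231 \<le> ln x" by linarith
  hence "x * 0.356865757231 \<le> x * ln x" by (intro mult_left_mono) (auto simp: x_def)
  hence "x * 0.356865757231 - x \<le> ln_primitive x" by (simp only: ln_primitive_def diff_right_mono)
  moreover have "- 1.837877066408 / 2 < x * 0.356865757231 - x" by (simp add: x_def)
  moreover have "1.837877066408 \<le> ln (2 * pi)" using ln_two_pi_bounds by auto
  ultimately have "- ln (2 * pi) / 2 < ln_primitive x" by simp
  thus ?thesis by (simp only: x_def)
qed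

lemma defect_zero_at_one:
  obtains a where "428844044 / 10 ^ 9 \<le> a" "a < 428844045 / 10 ^ 9" "defect a 1 = 0"
proof -
  let ?l = "1 + 428844044 / 10 ^ 9 :: real" and ?u = "1 + 428844045 / 10 ^ 9 :: real"
  have "\<exists>x. ?l \<le> x \<and> x \<le> ?u \<and> ln_primitive x = - ln (2 * pi) / 2"
    using ln_primitive_at_lower_decimal ln_primitive_at_upper_decimal
    by (intro IVT' continuous_on_ln_primitive) auto
  then obtain x where x: "?l \<le> x" "x \<le> ?u" "ln_primitive x = - ln (2 * pi) / 2"
    by blast
  moreover have "x \<noteq> ?u" using x(3) ln_primitive_at_upper_decimal by (metis less_irrefl)
  ultimately show thesis
    by (intro that[of "x - 1"]) (auto simp: defect_def)
qed

section \<open>The best possible shifts\<close>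

theorem theorem2p1:
  shows "\<exists>a_low a_up :: real.
      428844044 / 10 ^ 9 \<le> a_low \<and> a_low < 428844045 / 10 ^ 9 \<and> a_up = 1 / 2 \<and>
      (\<forall>n::nat. n \<ge> 1 \<longrightarrow> shifted_stirling a_low n \<le> fact n \<and> fact n < shifted_stirling a_up n) \<and>
      (\<forall>n::nat. n \<ge> 1 \<longrightarrow> (shifted_stirling a_low n = fact n \<longleftrightarrow> n = 1)) \<and>
      (\<forall>a. 0 \<le> a \<and> a < a_low \<longrightarrow> lower_shift a) \<and>
      (\<forall>a. lower_shift a \<longrightarrow> a \<le> a_low) \<and>
      (\<forall>a. upper_shift a \<longrightarrow> a_up \<le> a)"
proof -
  obtain b where b: "428844044 / 10 ^ 9 \<le> b" "b < 428844045 / 10 ^ 9" "defect b 1 = 0"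
    by (rule defect_zero_at_one)
  have b_range: "0 < b" "b < 1/2" using b by auto
  have b_pos: "defect b n > 0" if "n > 1" for n
    using defect_strict_increasing[of b 1 n] b_range b(3) that by simp
  have b_eq: "shifted_stirling b n = fact n \<longleftrightarrow> n = 1" if "n \<ge> 1" for n
    using shifted_stirling_eq_iff[of b n] b_pos[of n] b_range b(3) that by (cases "n = 1") auto
  have b_le: "shifted_stirling b n \<le> fact n" if "n \<ge> 1" for n
    using shifted_stirling_less_iff[of b n] b_eq[OF that] b_pos[of n] b_range that
    by (cases "n = 1") auto
  have upper: "fact n < shifted_stirling (1/2) n" if "n \<ge> 1" for n
    using shifted_stirling_greater_iff[of "1/2" n] defect_half_neg[OF that] that by simp
  have below: "lower_shift a" if "0 \<le> a" "a < b" for a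
  proof -
    have "defect a 1 > defect b 1"
      using that ln_primitive_strict_mono[of "1 + a" "1 + b"] by (simp add: defect_def)
    hence "defect a n > 0" if "n \<ge> 1" for n
      using defect_strict_increasing[of a 1 n] \<open>0 \<le> a\<close> \<open>a < b\<close> b_range b(3) that
      by (cases "n = 1") auto
    thus ?thesis using that shifted_stirling_less_iff[of a] by (auto simp: lower_shift_def)
  qed
  have lower_best: "a \<le> b" if "lower_shift a" for a
  proof (rule ccontr)
    assume "\<not> a \<le> b"
    hence "defect a 1 < defect b 1"
      using b_range ln_primitive_strict_mono[of "1 + b" "1 + a"] by (simp add: defect_def)
    moreover have "defect a 1 > 0"
      using that shifted_stirling_less_iff[of a 1] by (auto simp: lower_shift_def)
    ultimately show False using b(3) by simp
  qed
  have upper_best: "1/2 \<le> a" if "upper_shift a" for a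
  proof (rule ccontr)
    have a: "a > -1" "\<And>n. n \<ge> 1 \<Longrightarrow> defect a n < 0"
      using that shifted_stirling_greater_iff[of a] by (auto simp: upper_shift_def)
    assume "\<not> 1/2 \<le> a"
    with defect_eventually_pos[of a] a obtain n where "n \<ge> 1" "defect a n > 0" by auto
    with a(2)[of n] show False by simp
  qed
  show ?thesis
    using b b_le b_eq upper below lower_best upper_best
    by (intro exI[of _ b] exI[of _ "1/2"]) auto
qed

end
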